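(* Let $A$ be a finitely generated non-trivial abelian group. Then the wreath product $G=A\wr\mathbb{Z}=\left(\bigoplus_{i\in\mathbb{Z}}A\right)\rtimes\mathbb{Z}$ (with $\mathbb{Z}$ acting by shifting coordinates) does not have uniformly almost flat quotients (the u.q. property).
   Context: Let $G$ be an infinite group generated by a finite set $S$ and admitting a strictly decreasing sequence of finite-index subgroups. For a finite-index normal subgroup $N\trianglelefteq G$, $\operatorname{diam}_S(G/N)$ denotes the diameter of the Cayley graph of $G/N$ with respect to the image of $S$, i.e. the least $n\ge 0$ such that every element of $G/N$ is a product of at most $n$ images of elements of $S\cup S^{-1}$. For $\alpha\in(0,1]$, $G$ has uniformly $\alpha$-almost flat quotients, written u.q.$(\alpha)$, if there exists $\varepsilon>0$ such that $\operatorname{diam}_S(G/N)\ge \varepsilon [G:N]^\alpha$ for every proper finite-index normal subgroup $N\trianglelefteq G$; this does not depend on the choice of the finite generating set $S$. $G$ has uniformly almost flat quotients (the u.q. property) if it has u.q.$(\alpha)$ for some $\alpha\in(0,1]$. *)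

theory Defs
  imports "HOL-Algebra.Algebra"
begin

section \<open>The restricted wreath product with the integers\<close>

definition semidirect_product ::
  "('a, 'c) monoid_scheme \<Rightarrow> ('b, 'd) monoid_scheme \<Rightarrow> ('b \<Rightarrow> 'a \<Rightarrow> 'a) \<Rightarrow> ('a \<times> 'b) monoid"
  where "semidirect_product B H \<phi> =
    \<lparr>carrier = carrier B \<times> carrier H,
     monoid.mult = (\<lambda>(b, h) (b', h'). (b \<otimes>\<^bsub>B\<^esub> \<phi> h b', h \<otimes>\<^bsub>H\<^esub> h')),
     one = (\<one>\<^bsub>B\<^esub>, \<one>\<^bsub>H\<^esub>)\<rparr>"

definition shift :: "int \<Rightarrow> (int \<Rightarrow> 'a) \<Rightarrow> int \<Rightarrow> 'a"
  where "shift k f = (\<lambda>i. f (i - k))"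

text \<open>The base group \<^term>\<open>sum_group UNIV (\<lambda>_. A)\<close> is the group of finitely supported families.\<close>

definition wreath_int :: "('a, 'b) monoid_scheme \<Rightarrow> ((int \<Rightarrow> 'a) \<times> int) monoid"
  where "wreath_int A = semidirect_product (sum_group UNIV (\<lambda>_::int. A)) integer_group shift"


section \<open>Diameters of quotients and the u.q. property\<close>

definition finitely_generated_by :: "('a, 'b) monoid_scheme \<Rightarrow> 'a set \<Rightarrow> bool"
  where "finitely_generated_by G S \<longleftrightarrow> finite S \<and> S \<subseteq> carrier G \<and> generate G S = carrier G"

definition quotient_diam :: "('a, 'b) monoid_scheme \<Rightarrow> 'a set \<Rightarrow> 'a set \<Rightarrow> nat"
  where "quotient_diam G S N =
    (LEAST n. \<forall>x \<in> carrier (G Mod N). \<exists>ws.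
        set ws \<subseteq> (\<lambda>s. N #>\<^bsub>G\<^esub> s) ` (S \<union> m_inv G ` S) \<and> length ws \<le> n \<and>
        foldr (\<lambda>u v. u \<otimes>\<^bsub>G Mod N\<^esub> v) ws \<one>\<^bsub>G Mod N\<^esub> = x)"

text \<open>
  The index of \<open>N\<close> is \<^term>\<open>order (G Mod N)\<close>, the cardinality of the set of cosets;
  finiteness of the index is required separately, as \<open>order\<close> is 0 for an infinite quotient.
  Both notions below are meant for an infinite group \<open>G\<close> with finite generating set \<open>S\<close> that has
  a strictly decreasing sequence of finite-index subgroups; the last section shows that these
  standing assumptions hold for the wreath products in question.
\<close>

definition uq_alpha :: "('a, 'b) monoid_scheme \<Rightarrow> 'a set \<Rightarrow> real \<Rightarrow> bool"
  where "uq_alpha G S \<alpha> \<longleftrightarrow>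
    (\<exists>\<epsilon>::real. \<epsilon> > 0 \<and>
      (\<forall>N. N \<lhd> G \<and> finite (carrier (G Mod N)) \<and> N \<noteq> carrier G \<longrightarrow>
        real (quotient_diam G S N) \<ge> \<epsilon> * real (order (G Mod N)) powr \<alpha>))"

definition uniformly_almost_flat_quotients :: "('a, 'b) monoid_scheme \<Rightarrow> 'a set \<Rightarrow> bool"
  where "uniformly_almost_flat_quotients G S \<longleftrightarrow> (\<exists>\<alpha>. 0 < \<alpha> \<and> \<alpha> \<le> 1 \<and> uq_alpha G S \<alpha>)"


section \<open>The standing assumptions hold for wreath products with the integers\<close>

lemma carrier_wreath_int:
  assumes "group A"
  shows "carrier (wreath_int A) =
    {(f, k). (\<forall>i. f i \<in> carrier A) \<and> finite {i. f i \<noteq> \<one>\<^bsub>A\<^esub>}}"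
  using assms by (auto simp: wreath_int_def semidirect_product_def carrier_sum_group PiE_iff)

lemma mult_wreath_int:
  "(f, k) \<otimes>\<^bsub>wreath_int A\<^esub> (g, l) = (\<lambda>i. f i \<otimes>\<^bsub>A\<^esub> g (i - k), k + l)"
  by (simp add: wreath_int_def semidirect_product_def shift_def restrict_def)

lemma one_wreath_int: "\<one>\<^bsub>wreath_int A\<^esub> = (\<lambda>i. \<one>\<^bsub>A\<^esub>, 0)"
  by (simp add: wreath_int_def semidirect_product_def restrict_def)

lemma finite_shift: "finite {i::int. P i} \<Longrightarrow> finite {i. P (i - k)}"
  by (rule finite_surj[where f = "\<lambda>i. i + k"]) (auto intro: image_eqI[where x = "_ - k"])

lemma group_wreath_int:
  assumes "group A"
  shows "group (wreath_int A)"
proof -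
  interpret A: group A by fact
  let ?G = "wreath_int A"
  show ?thesis
  proof (rule groupI)
    fix x y assume xy: "x \<in> carrier ?G" "y \<in> carrier ?G"
    obtain f k g l where eq: "x = (f, k)" "y = (g, l)" by (metis surj_pair)
    have fin: "finite {i. f i \<noteq> \<one>\<^bsub>A\<^esub>}" "finite {i. g (i - k) \<noteq> \<one>\<^bsub>A\<^esub>}"
      and cl: "f i \<in> carrier A" "g i \<in> carrier A" for i
      using xy eq finite_shift[of "\<lambda>i. g i \<noteq> \<one>\<^bsub>A\<^esub>" k] by (auto simp: carrier_wreath_int[OF assms])
    have "finite {i. f i \<otimes>\<^bsub>A\<^esub> g (i - k) \<noteq> \<one>\<^bsub>A\<^esub>}"
      by (rule finite_subset[OF _ finite_UnI[OF fin]]) auto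
    then show "x \<otimes>\<^bsub>?G\<^esub> y \<in> carrier ?G"
      using cl eq by (auto simp: carrier_wreath_int[OF assms] mult_wreath_int)
  next
    show "\<one>\<^bsub>?G\<^esub> \<in> carrier ?G"
      by (simp add: carrier_wreath_int[OF assms] one_wreath_int)
  next
    fix x y z assume "x \<in> carrier ?G" "y \<in> carrier ?G" "z \<in> carrier ?G"
    then show "x \<otimes>\<^bsub>?G\<^esub> y \<otimes>\<^bsub>?G\<^esub> z = x \<otimes>\<^bsub>?G\<^esub> (y \<otimes>\<^bsub>?G\<^esub> z)"
      by (auto simp: carrier_wreath_int[OF assms] mult_wreath_int A.m_assoc algebra_simps)
  next
    fix x assume "x \<in> carrier ?G"
    then show "\<one>\<^bsub>?G\<^esub> \<otimes>\<^bsub>?G\<^esub> x = x"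
      by (auto simp: carrier_wreath_int[OF assms] mult_wreath_int one_wreath_int)
  next
    fix x assume x: "x \<in> carrier ?G"
    obtain f k where eq: "x = (f, k)" by (metis surj_pair)
    have fin: "finite {i. f i \<noteq> \<one>\<^bsub>A\<^esub>}" and cl: "f i \<in> carrier A" for i
      using x eq by (auto simp: carrier_wreath_int[OF assms])
    have "finite {i. f (i - (- k)) \<noteq> \<one>\<^bsub>A\<^esub>}" using fin by (rule finite_shift)
    then have "finite {i. inv\<^bsub>A\<^esub> f (i + k) \<noteq> \<one>\<^bsub>A\<^esub>}"
      by (simp add: A.inv_eq_1_iff[OF cl])
    then have "(\<lambda>i. inv\<^bsub>A\<^esub> f (i + k), - k) \<in> carrier ?G"
      using cl by (auto simp: carrier_wreath_int[OF assms])
    moreover have "(\<lambda>i. inv\<^bsub>A\<^esub> f (i + k), - k) \<otimes>\<^bsub>?G\<^esub> x = \<one>\<^bsub>?G\<^esub>"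
      using cl by (simp add: eq mult_wreath_int one_wreath_int A.l_inv)
    ultimately show "\<exists>y \<in> carrier ?G. y \<otimes>\<^bsub>?G\<^esub> x = \<one>\<^bsub>?G\<^esub>" by blast
  qed
qed

lemma finitely_generated_wreath_int:
  assumes A: "group A" and T: "finitely_generated_by A T"
  shows "\<exists>S. finitely_generated_by (wreath_int A) S"
proof -
  interpret A: group A by fact
  interpret G: group "wreath_int A" using A by (rule group_wreath_int)
  let ?G = "wreath_int A"
  define \<delta> where "\<delta> = (\<lambda>(j::int) a. (\<lambda>i. if i = j then a else \<one>\<^bsub>A\<^esub>, 0::int))"
  define t where "t = (\<lambda>k::int. (\<lambda>i::int. \<one>\<^bsub>A\<^esub>, k))"
  define S where "S = insert (t 1) (\<delta> 0 ` T)"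
  have TA: "T \<subseteq> carrier A" "finite T" "generate A T = carrier A"
    using T by (auto simp: finitely_generated_by_def)
  have \<delta>c: "\<delta> j a \<in> carrier ?G" if "a \<in> carrier A" for j a
    using that by (auto simp: \<delta>_def carrier_wreath_int[OF A])
  have tc: "t k \<in> carrier ?G" for k
    by (auto simp: t_def carrier_wreath_int[OF A])
  have S: "S \<subseteq> carrier ?G" using TA \<delta>c tc by (auto simp: S_def)
  let ?H = "generate ?G S"
  interpret H: subgroup ?H ?G by (rule G.generate_is_subgroup[OF S])
  have t1: "t 1 \<in> ?H" by (auto simp: S_def intro: generate.incl)
  have tadd: "t k \<otimes>\<^bsub>?G\<^esub> t l = t (k + l)" for k l
    by (simp add: t_def mult_wreath_int)
  have tinv: "inv\<^bsub>?G\<^esub> t k = t (- k)" for k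
    by (rule G.inv_equality) (auto simp: tadd tc, simp add: t_def one_wreath_int)
  have tnat: "t (int n) \<in> ?H" for n
  proof (induction n)
    case 0
    show ?case using H.one_closed by (simp add: t_def one_wreath_int)
  next
    case (Suc n)
    show ?case using H.m_closed[OF Suc t1] by (simp add: tadd add.commute)
  qed
  have tH: "t k \<in> ?H" for k
  proof (cases "k \<ge> 0")
    case True
    then show ?thesis using tnat[of "nat k"] by simp
  next
    case False
    then show ?thesis using H.m_inv_closed[OF tnat[of "nat (- k)"]] by (simp add: tinv)
  qed
  have \<delta>mult: "\<delta> j a \<otimes>\<^bsub>?G\<^esub> \<delta> j b = \<delta> j (a \<otimes>\<^bsub>A\<^esub> b)" if "a \<in> carrier A" "b \<in> carrier A" for j a b
    using that by (auto simp: \<delta>_def mult_wreath_int)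
  have \<delta>one: "\<delta> j \<one>\<^bsub>A\<^esub> = \<one>\<^bsub>?G\<^esub>" for j
    by (auto simp: \<delta>_def one_wreath_int)
  have \<delta>0: "\<delta> 0 a \<in> ?H" if "a \<in> generate A T" for a
    using that
  proof (induction rule: generate.induct)
    case one
    show ?case by (simp add: \<delta>one)
  next
    case (incl h)
    then show ?case by (auto simp: S_def intro: generate.incl)
  next
    case (inv h)
    then have h: "h \<in> carrier A" and "\<delta> 0 h \<in> ?H"
      using TA by (auto simp: S_def intro: generate.incl)
    moreover have "inv\<^bsub>?G\<^esub> \<delta> 0 h = \<delta> 0 (inv\<^bsub>A\<^esub> h)"
      by (rule G.inv_equality) (auto simp: \<delta>mult \<delta>one \<delta>c h A.l_inv)
    ultimately show ?case using H.m_inv_closed by metis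
  next
    case (eng h1 h2)
    then show ?case using TA(3) by (metis H.m_closed \<delta>mult)
  qed
  have \<delta>H: "\<delta> j a \<in> ?H" if a: "a \<in> carrier A" for j a
  proof -
    have "t j \<otimes>\<^bsub>?G\<^esub> \<delta> 0 a \<otimes>\<^bsub>?G\<^esub> t (- j) = \<delta> j a"
      using a by (auto simp: t_def \<delta>_def mult_wreath_int)
    then show ?thesis using a TA(3) \<delta>0 tH by (metis H.m_closed)
  qed
  have base: "(f, 0) \<in> ?H"
    if "finite F" "\<forall>i. f i \<in> carrier A" "{i. f i \<noteq> \<one>\<^bsub>A\<^esub>} \<subseteq> F" for F f
    using that
  proof (induction F arbitrary: f rule: finite_induct)
    case empty
    then have "(f, 0) = \<one>\<^bsub>?G\<^esub>" by (auto simp: one_wreath_int)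
    then show ?case by simp
  next
    case (insert j F)
    let ?f = "f(j := \<one>\<^bsub>A\<^esub>)"
    have "(?f, 0) \<in> ?H" using insert.prems by (intro insert.IH) auto
    moreover have "(f, 0) = \<delta> j (f j) \<otimes>\<^bsub>?G\<^esub> (?f, 0)"
      using insert.prems by (auto simp: \<delta>_def mult_wreath_int)
    ultimately show ?case using insert.prems \<delta>H by auto
  qed
  have "carrier ?G \<subseteq> ?H"
  proof
    fix x assume x: "x \<in> carrier ?G"
    obtain f k where eq: "x = (f, k)" by (metis surj_pair)
    have "(f, 0) \<in> ?H" using x eq by (intro base) (auto simp: carrier_wreath_int[OF A])
    moreover have "x = (f, 0) \<otimes>\<^bsub>?G\<^esub> t k"
      using x eq by (auto simp: t_def mult_wreath_int carrier_wreath_int[OF A])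
    ultimately show "x \<in> ?H" using tH by auto
  qed
  then have "?H = carrier ?G" using H.subset by blast
  then show ?thesis using S TA(2) unfolding finitely_generated_by_def
    by (intro exI[of _ S]) (simp add: S_def)
qed

lemma infinite_wreath_int:
  assumes "group A"
  shows "infinite (carrier (wreath_int A))"
proof -
  have "range (\<lambda>k::int. (\<lambda>i::int. \<one>\<^bsub>A\<^esub>, k)) \<subseteq> carrier (wreath_int A)"
    using assms by (auto simp: carrier_wreath_int group.is_monoid)
  moreover have "infinite (range (\<lambda>k::int. (\<lambda>i::int. \<one>\<^bsub>A\<^esub>, k)))"
    by (subst finite_image_iff) (auto simp: inj_on_def infinite_UNIV_int)
  ultimately show ?thesis using finite_subset by blast
qed

lemma decreasing_finite_index_wreath_int:
  assumes A: "group A"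
  shows "\<exists>H :: nat \<Rightarrow> _. \<forall>n. subgroup (H n) (wreath_int A) \<and>
    finite (rcosets\<^bsub>wreath_int A\<^esub> H n) \<and> H (Suc n) \<subset> H n"
proof -
  interpret A: group A by fact
  interpret G: group "wreath_int A" using A by (rule group_wreath_int)
  let ?G = "wreath_int A"
  define H where "H = (\<lambda>n::nat. {x \<in> carrier ?G. (2::int) ^ n dvd snd x})"
  define t where "t = (\<lambda>k::int. (\<lambda>i::int. \<one>\<^bsub>A\<^esub>, k))"
  have tc: "t k \<in> carrier ?G" for k
    by (auto simp: t_def carrier_wreath_int[OF A])
  have sndm: "snd (x \<otimes>\<^bsub>?G\<^esub> y) = snd x + snd y" for x y
    by (cases x, cases y) (simp add: mult_wreath_int)
  have sndi: "snd (inv\<^bsub>?G\<^esub> x) = - snd x" if "x \<in> carrier ?G" for x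
    using sndm[of "inv\<^bsub>?G\<^esub> x" x] G.l_inv[OF that] by (simp add: one_wreath_int)
  have sub: "subgroup (H n) ?G" for n
  proof (rule G.subgroupI)
    have "\<one>\<^bsub>?G\<^esub> \<in> H n" unfolding H_def using G.one_closed by (simp add: one_wreath_int)
    then show "H n \<noteq> {}" by blast
  qed (auto simp: H_def sndm sndi)
  have fin: "finite (rcosets\<^bsub>?G\<^esub> H n)" for n
  proof -
    have "rcosets\<^bsub>?G\<^esub> H n \<subseteq> (\<lambda>k. H n #>\<^bsub>?G\<^esub> t k) ` {0..<2 ^ n}"
    proof
      fix C assume "C \<in> rcosets\<^bsub>?G\<^esub> H n"
      then obtain x where x: "x \<in> carrier ?G" and C: "C = H n #>\<^bsub>?G\<^esub> x"
        by (auto simp: RCOSETS_def)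
      let ?k = "snd x mod 2 ^ n"
      have "x \<otimes>\<^bsub>?G\<^esub> inv\<^bsub>?G\<^esub> t ?k \<in> H n"
        using x tc by (simp add: H_def sndm sndi) (simp add: t_def)
      moreover have "x = (x \<otimes>\<^bsub>?G\<^esub> inv\<^bsub>?G\<^esub> t ?k) \<otimes>\<^bsub>?G\<^esub> t ?k"
        using x tc by (simp add: G.m_assoc)
      ultimately have "x \<in> H n #>\<^bsub>?G\<^esub> t ?k" by (auto simp: r_coset_def)
      then have "C = H n #>\<^bsub>?G\<^esub> t ?k"
        using C G.repr_independence[OF _ tc sub] by metis
      then show "C \<in> (\<lambda>k. H n #>\<^bsub>?G\<^esub> t k) ` {0..<2 ^ n}" by auto
    qed
    then show ?thesis by (rule finite_subset) simp
  qed
  have "H (Suc n) \<subset> H n" for n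
  proof
    show "H (Suc n) \<subseteq> H n" by (auto simp: H_def dest: dvd_mult_right)
    have "t (2 ^ n) \<in> H n" using tc by (simp add: H_def) (simp add: t_def)
    moreover have "t (2 ^ n) \<notin> H (Suc n)"
      by (auto simp: H_def t_def dest: zdvd_imp_le)
    ultimately show "H (Suc n) \<noteq> H n" by blast
  qed
  then show ?thesis using sub fin by blast
qed

end

theory Submission
  imports Defs
begin

text \<open>Let \<open>B\<close> be a proper subgroup of finite index in \<open>A\<close>. Reducing the coordinates modulo \<open>B\<close> and
  wrapping \<open>\<int>\<close> around to \<open>\<int>/n\<close> gives the finite quotient \<open>(A/B) \<wr> \<int>/n\<close> of \<open>A \<wr> \<int>\<close>, of order at
  least \<open>2\<^sup>n\<close>. Its diameter is only \<open>O(n)\<close>, since a cursor visiting the \<open>n\<close> coordinates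
  once can write an arbitrary family, and \<open>O(n)\<close> is not bounded below by any \<open>\<epsilon> 2\<^bsup>\<alpha>n\<^esup>\<close>.\<close>

section \<open>Proper subgroups of finite index in finitely generated abelian groups\<close>

text \<open>This is \<open>C\<close> times the cyclic subgroup generated by \<open>x [^] m\<close>.
  Keeping \<open>m\<close> as a parameter makes \<open>m = 1\<close> (the span of \<open>C\<close>
  and \<open>x\<close>) and \<open>m = 2\<close> members of one family.\<close>

lemma (in comm_group) subgroup_adjoin_int_pow:
  fixes m :: int
  assumes C: "subgroup C G" and x: "x \<in> carrier G"
  shows "subgroup {c \<otimes> x [^] (m * k) | c k. c \<in> C} G" (is "subgroup ?H G")
proof -
  interpret C: subgroup C G by fact
  show ?thesis
  proof (rule subgroupI)
    have "\<one> \<otimes> x [^] (m * 0) \<in> ?H" using C.one_closed by blast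
    then show "?H \<noteq> {}" by blast
  next
    fix a assume "a \<in> ?H"
    then obtain c k where c: "c \<in> C" "a = c \<otimes> x [^] (m * k)" by blast
    then have "inv a = inv c \<otimes> x [^] (m * (- k))"
      using x by (simp add: inv_mult int_pow_neg)
    with C.m_inv_closed[OF c(1)] show "inv a \<in> ?H" by blast
  next
    fix a b assume "a \<in> ?H" "b \<in> ?H"
    then obtain c k d l where cd: "c \<in> C" "d \<in> C"
      and ab: "a = c \<otimes> x [^] (m * k)" "b = d \<otimes> x [^] (m * l)" by blast
    have "a \<otimes> b = (c \<otimes> d) \<otimes> x [^] (m * (k + l))"
      using x cd by (simp add: ab int_pow_mult distrib_left m_ac)
    with C.m_closed[OF cd] show "a \<otimes> b \<in> ?H" by blast
  qed (use x in auto)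
qed

text \<open>Dropping one element \<open>x\<close> from a generating set of minimal size gives a proper subgroup \<open>C\<close>
  with cyclic quotient. Either \<open>C \<langle>x\<^sup>2\<rangle>\<close> is still proper, or \<open>x \<in> C \<langle>x\<^sup>2\<rangle>\<close> and then \<open>x\<close> has finite
  order modulo \<open>C\<close>.\<close>

lemma (in comm_group) ex_proper_subgroup_finite_transversal:
  assumes "finite T" "T \<subseteq> carrier G" "generate G T = carrier G" "carrier G \<noteq> {\<one>}"
  shows "\<exists>B R. subgroup B G \<and> B \<noteq> carrier G \<and> finite R \<and> R \<subseteq> carrier G \<and> \<one> \<in> R \<and>
    (\<forall>a \<in> carrier G. \<exists>r \<in> R. a \<otimes> inv r \<in> B)"
proof -
  define gen where "gen = (\<lambda>T. finite T \<and> T \<subseteq> carrier G \<and> generate G T = carrier G)"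
  have "gen T" using assms by (simp add: gen_def)
  then obtain T where T: "gen T" and min: "\<And>U. gen U \<Longrightarrow> card T \<le> card U"
    using ex_has_least_nat[of gen T card] by blast
  have "T \<noteq> {}"
    using T assms(4) generate_empty by (auto simp: gen_def)
  then obtain x where xT: "x \<in> T" by blast
  define C where "C = generate G (T - {x})"
  have x: "x \<in> carrier G" and TC: "T - {x} \<subseteq> carrier G" using T xT by (auto simp: gen_def)
  interpret C: subgroup C G unfolding C_def by (rule generate_is_subgroup[OF TC])
  have "\<not> gen (T - {x})"
    using min[of "T - {x}"] card_Diff1_less[OF _ xT] T by (force simp: gen_def)
  then have Cne: "C \<noteq> carrier G" using T TC by (auto simp: gen_def C_def)
  define H where "H = (\<lambda>m::int. {c \<otimes> x [^] (m * k) | c k. c \<in> C})"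
  have sub: "subgroup (H m) G" for m
    unfolding H_def by (rule subgroup_adjoin_int_pow[OF C.subgroup_axioms x])
  \<comment> \<open>Adjoining \<open>x\<close> to \<open>C\<close> recovers the whole group, so the
    quotient by \<open>C\<close> is cyclic, generated by the class of \<open>x\<close>.\<close>
  have "T \<subseteq> H 1"
  proof
    fix y assume y: "y \<in> T"
    have "\<one> \<otimes> x [^] (1 * 1::int) \<in> H 1" unfolding H_def using C.one_closed by blast
    moreover have "y \<otimes> x [^] (1 * 0::int) \<in> H 1" if "y \<in> C" unfolding H_def using that by blast
    moreover have "y \<in> C" if "y \<noteq> x"
      unfolding C_def using y that by (intro generate.incl) auto
    ultimately show "y \<in> H 1" using x by (cases "y = x") auto
  qed
  then have "carrier G \<subseteq> H 1"
    using generate_subgroup_incl[OF _ sub[of 1], of T] T by (auto simp: gen_def)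
  then have decomp: "\<exists>c \<in> C. \<exists>k::int. a = c \<otimes> x [^] k" if "a \<in> carrier G" for a
    using that by (auto simp: H_def)
  show ?thesis
  proof (cases "H 2 = carrier G")
    case False
    \<comment> \<open>The parity of the exponent of \<open>x\<close> decides which of
      \<open>\<one>\<close> and \<open>x\<close> represents \<open>a\<close> modulo
      \<open>H 2\<close>.\<close>
    have "\<exists>r \<in> {\<one>, x}. a \<otimes> inv r \<in> H 2" if a: "a \<in> carrier G" for a
    proof -
      obtain c k where c: "c \<in> C" "a = c \<otimes> x [^] (k::int)" using decomp[OF a] by blast
      show ?thesis
      proof (cases "even k")
        case True
        then obtain j where "k = 2 * j" by blast
        then show ?thesis using c a by (auto simp: H_def)
      next
        case False
        then obtain j where "k = 2 * j + 1" by (auto elim: oddE)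
        then have "a \<otimes> inv x = c \<otimes> x [^] (2 * j)"
          using c x by (simp add: int_pow_mult m_assoc)
        then show ?thesis using c by (auto simp: H_def)
      qed
    qed
    with False sub[of 2] x show ?thesis by (intro exI[of _ "H 2"] exI[of _ "{\<one>, x}"]) auto
  next
    case True
    then obtain c k where c: "c \<in> C" and xc: "x = c \<otimes> x [^] (2 * k::int)"
      using x unfolding H_def by blast
    have "c = x \<otimes> inv (x [^] (2 * k))"
      by (rule iffD2[OF inv_solve_right xc]) (use c x in simp_all)
    also have "\<dots> = x [^] (1 - 2 * k)"
      unfolding int_pow_diff[OF x] by (simp only: int_pow_1[OF x])
    finally have pow: "x [^] (1 - 2 * k) \<in> C" using c by (rule subst)
    \<comment> \<open>The exponent \<open>1 - 2 * k\<close> is odd, hence nonzero, so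
      \<open>m\<close> is positive. Since \<open>x [^] m\<close> lies in \<open>C\<close>, exponents
      matter only modulo \<open>m\<close> and the powers with exponent in \<open>{0..<m}\<close>
      form a transversal.\<close>
    define m where "m = \<bar>1 - 2 * k\<bar>"
    have m: "x [^] m \<in> C"
    proof (cases "1 - 2 * k < 0")
      case True
      then have "m = - (1 - 2 * k)" by (simp add: m_def)
      then show ?thesis using C.m_inv_closed[OF pow] by (simp only: int_pow_neg[OF x])
    next
      case False
      then have "m = 1 - 2 * k" by (simp add: m_def)
      then show ?thesis using pow by (simp only:)
    qed
    have m0: "m > 0" unfolding m_def by presburger
    define R where "R = (\<lambda>j. x [^] j) ` {0..<m}"
    have "\<exists>r \<in> R. a \<otimes> inv r \<in> C" if a: "a \<in> carrier G" for a
    proof -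
      obtain d l where d: "d \<in> C" "a = d \<otimes> x [^] (l::int)" using decomp[OF a] by blast
      have "a \<otimes> inv (x [^] (l mod m)) = d \<otimes> x [^] (l - l mod m)"
        using d x by (simp add: int_pow_diff m_assoc)
      also have "l - l mod m = m * (l div m)" by (simp add: minus_mod_eq_mult_div)
      also have "x [^] \<dots> = (x [^] m) [^] (l div m)" by (rule int_pow_pow[OF x, symmetric])
      also have "d \<otimes> \<dots> \<in> C"
        by (intro C.m_closed d subgroup_int_pow_closed[OF C.subgroup_axioms m])
      finally have "a \<otimes> inv (x [^] (l mod m)) \<in> C" .
      moreover have "x [^] (l mod m) \<in> R" using m0 by (simp add: R_def)
      ultimately show ?thesis by blast
    qed
    moreover have "\<one> \<in> R" unfolding R_def using m0 by (intro image_eqI[where x = 0]) auto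
    moreover have "finite R" "R \<subseteq> carrier G" using x by (auto simp: R_def)
    ultimately show ?thesis using C.subgroup_axioms Cne by blast
  qed
qed

section \<open>Diameters of quotients\<close>

text \<open>The shape agrees with the product of cosets inside \<open>quotient_diam\<close>, so
  words in the quotient are literal instances.\<close>

abbreviation word_prod :: "('a, 'b) monoid_scheme \<Rightarrow> 'a list \<Rightarrow> 'a"
  where "word_prod G us \<equiv> foldr (\<lambda>u v. u \<otimes>\<^bsub>G\<^esub> v) us \<one>\<^bsub>G\<^esub>"

lemma (in monoid) word_prod_closed: "set us \<subseteq> carrier G \<Longrightarrow> word_prod G us \<in> carrier G"
  by (induction us) auto

lemma (in monoid) word_prod_append:
  "set us \<subseteq> carrier G \<Longrightarrow> set vs \<subseteq> carrier G \<Longrightarrow> word_prod G (us @ vs) = word_prod G us \<otimes> word_prod G vs"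
  by (induction us) (auto simp: word_prod_closed m_assoc)

lemma (in normal) word_prod_FactGroup:
  "set us \<subseteq> carrier G \<Longrightarrow> word_prod (G Mod H) (map (\<lambda>s. H #> s) us) = H #> word_prod G us"
  by (induction us) (auto simp: word_prod_closed rcos_sum coset_join2 subgroup_axioms)

lemma (in group) generate_imp_word:
  assumes S: "S \<subseteq> carrier G" and "a \<in> generate G S"
  shows "\<exists>us. set us \<subseteq> S \<union> m_inv G ` S \<and> word_prod G us = a"
    (is "\<exists>us. set us \<subseteq> ?S \<and> _")
  using assms(2)
proof (induction rule: generate.induct)
  case one
  show ?case by (intro exI[of _ "[]"]) simp
next
  case (incl h)
  then show ?case using S by (intro exI[of _ "[h]"]) auto
next
  case (inv h)
  then show ?case using S by (intro exI[of _ "[inv h]"]) auto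
next
  case (eng h1 h2)
  then obtain us vs where "set us \<subseteq> S \<union> m_inv G ` S" "word_prod G us = h1"
      "set vs \<subseteq> S \<union> m_inv G ` S" "word_prod G vs = h2" by blast
  moreover have "?S \<subseteq> carrier G" using S by auto
  ultimately show ?case
    using word_prod_append[of us vs] by (intro exI[of _ "us @ vs"]) (auto simp del: foldr_append)
qed

text \<open>Rewriting each letter from \<open>Y\<close> as a word over \<open>S\<close> and its
  inverses costs a constant factor. That factor \<open>L\<close> is chosen before \<open>N\<close>
  and \<open>m\<close>, so it serves all quotients at once, and word lengths can be counted in a
  convenient alphabet \<open>Y\<close> instead of the arbitrary \<open>S\<close>.\<close>

lemma (in group) quotient_diam_le_words:
  assumes S: "S \<subseteq> carrier G" "generate G S = carrier G"
    and Y: "finite Y" "Y \<subseteq> carrier G"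
  shows "\<exists>L. \<forall>N m. N \<lhd> G \<longrightarrow>
    (\<forall>x \<in> carrier G. \<exists>us. set us \<subseteq> Y \<and> length us \<le> m \<and> x \<in> N #> word_prod G us) \<longrightarrow>
    quotient_diam G S N \<le> L * m"
proof -
  let ?S = "S \<union> m_inv G ` S"
  have S': "?S \<subseteq> carrier G" using S by auto
  have "\<exists>w. \<forall>x \<in> Y. set (w x) \<subseteq> ?S \<and> word_prod G (w x) = x"
    using generate_imp_word[OF S(1)] S(2) Y(2) by (intro bchoice) blast
  then obtain w where w: "\<And>x. x \<in> Y \<Longrightarrow> set (w x) \<subseteq> ?S \<and> word_prod G (w x) = x" by blast
  \<comment> \<open>The sum is a common bound for the lengths of all \<open>w x\<close>, also when
    \<open>Y\<close> is empty.\<close>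
  define L where "L = (\<Sum>x\<in>Y. length (w x))"
  have wL: "length (w x) \<le> L" if "x \<in> Y" for x
    unfolding L_def using Y(1) that by (intro member_le_sum) auto
  have concat: "set (concat (map w us)) \<subseteq> ?S \<and> length (concat (map w us)) \<le> L * length us \<and>
      word_prod G (concat (map w us)) = word_prod G us" if "set us \<subseteq> Y" for us
    using that
  proof (induction us)
    case (Cons u us)
    then have u: "set (w u) \<subseteq> ?S" "word_prod G (w u) = u" "length (w u) \<le> L" using w wL by auto
    moreover have "word_prod G (w u @ concat (map w us)) = word_prod G (w u) \<otimes> word_prod G (concat (map w us))"
      by (rule word_prod_append; rule subset_trans[OF _ S']) (use u Cons in auto)
    ultimately show ?case using Cons by (auto simp del: foldr_append)
  qed simp
  have "quotient_diam G S N \<le> L * m"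
    if N: "N \<lhd> G"
      and ex: "\<forall>x \<in> carrier G. \<exists>us. set us \<subseteq> Y \<and> length us \<le> m \<and> x \<in> N #> word_prod G us" for N m
  proof -
    interpret N: normal N G by fact
    have "\<exists>ws. set ws \<subseteq> (\<lambda>s. N #> s) ` ?S \<and> length ws \<le> L * m \<and> word_prod (G Mod N) ws = y"
      if "y \<in> carrier (G Mod N)" for y
    proof -
      obtain x where x: "x \<in> carrier G" "y = N #> x"
        using \<open>y \<in> carrier (G Mod N)\<close> by (auto simp: carrier_FactGroup)
      obtain us where us: "set us \<subseteq> Y" "length us \<le> m" "x \<in> N #> word_prod G us"
        using ex x by blast
      let ?ws = "concat (map w us)"
      have ws: "set ?ws \<subseteq> ?S" "length ?ws \<le> L * length us" "word_prod G ?ws = word_prod G us"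
        using concat[OF us(1)] by auto
      have "y = N #> word_prod G us"
        using repr_independence[OF us(3) word_prod_closed N.subgroup_axioms] x us Y by auto
      then have "word_prod (G Mod N) (map (\<lambda>s. N #> s) ?ws) = y"
        using ws S' by (subst N.word_prod_FactGroup) auto
      moreover have "length ?ws \<le> L * m"
        using ws(2) us(2) by (meson le_trans mult_le_mono2)
      ultimately show ?thesis using ws(1)
        by (intro exI[of _ "map (\<lambda>s. N #> s) ?ws"]) auto
    qed
    then show ?thesis unfolding quotient_diam_def by (intro Least_le) blast
  qed
  then show ?thesis by blast
qed

section \<open>Finite quotients of the wreath product\<close>

text \<open>\<open>finprod\<close> is \<open>\<one>\<close> on infinite index sets, hence the restriction to the support.\<close>

definition class_prod :: "('a, 'b) monoid_scheme \<Rightarrow> int \<Rightarrow> int \<Rightarrow> (int \<Rightarrow> 'a) \<Rightarrow> 'a"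
  where "class_prod A n r f = finprod A f {i. n dvd i - r \<and> f i \<noteq> \<one>\<^bsub>A\<^esub>}"

text \<open>The kernel of the map \<open>A \<wr> \<int> \<rightarrow> (A/B) \<wr> \<int>/n\<close>.\<close>

definition class_subgroup ::
  "('a, 'b) monoid_scheme \<Rightarrow> 'a set \<Rightarrow> int \<Rightarrow> ((int \<Rightarrow> 'a) \<times> int) set"
  where "class_subgroup A B n =
    {(f, k) \<in> carrier (wreath_int A). n dvd k \<and> (\<forall>r. class_prod A n r f \<in> B)}"

section \<open>Products over residue classes, and normality of the kernel\<close>

context comm_group
begin

lemma class_prod_closed:
  "(f, k) \<in> carrier (wreath_int G) \<Longrightarrow> class_prod G n r f \<in> carrier G"
  unfolding class_prod_def
  by (rule finprod_closed) (auto simp: carrier_wreath_int[OF is_group])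

lemma class_prod_cong:
  assumes "n dvd r - s"
  shows "class_prod G n r f = class_prod G n s f"
proof -
  have "n dvd i - r \<longleftrightarrow> n dvd i - s" for i
    using assms dvd_add_right_iff[of n "r - s" "i - r"] by simp
  then show ?thesis by (simp add: class_prod_def)
qed

lemma class_prod_one: "class_prod G n r (\<lambda>i. \<one>) = \<one>"
  by (simp add: class_prod_def)

lemma class_prod_shift:
  assumes "(f, k) \<in> carrier (wreath_int G)"
  shows "class_prod G n r (\<lambda>i. f (i - l)) = class_prod G n (r - l) f"
proof -
  let ?A = "{i. n dvd i - (r - l) \<and> f i \<noteq> \<one>}"
  have "{i. n dvd i - r \<and> f (i - l) \<noteq> \<one>} = (\<lambda>i. i + l) ` ?A"
  proof (intro equalityI subsetI)
    fix i assume "i \<in> {i. n dvd i - r \<and> f (i - l) \<noteq> \<one>}"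
    then show "i \<in> (\<lambda>i. i + l) ` ?A" by (intro image_eqI[of _ _ "i - l"]) auto
  qed (auto simp: algebra_simps)
  then show ?thesis
    unfolding class_prod_def
    using assms by (simp add: finprod_reindex Pi_def carrier_wreath_int[OF is_group])
qed

lemma class_prod_mult:
  assumes f: "(f, k) \<in> carrier (wreath_int G)" and g: "(g, l) \<in> carrier (wreath_int G)"
  shows "class_prod G n r (\<lambda>i. f i \<otimes> g i) = class_prod G n r f \<otimes> class_prod G n r g"
proof -
  \<comment> \<open>The three supports may differ, and \<open>f i \<otimes> g i\<close> can be
    trivial where neither factor is. All products are therefore extended by trivial factors to the
    common index set \<open>?F\<close>.\<close>
  let ?F = "{i. n dvd i - r \<and> (f i \<noteq> \<one> \<or> g i \<noteq> \<one>)}"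
  have cl: "f i \<in> carrier G" "g i \<in> carrier G" for i
    using f g by (auto simp: carrier_wreath_int[OF is_group])
  have "finite {i. f i \<noteq> \<one>}" "finite {i. g i \<noteq> \<one>}"
    using f g by (auto simp: carrier_wreath_int[OF is_group])
  then have fin: "finite ?F" by (rule rev_finite_subset[OF finite_UnI]) auto
  have "class_prod G n r h = finprod G h ?F"
    if "\<And>i. h i \<in> carrier G" "\<And>i. h i \<noteq> \<one> \<Longrightarrow> f i \<noteq> \<one> \<or> g i \<noteq> \<one>" for h
    unfolding class_prod_def using that by (intro finprod_mono_neutral_cong_left[OF fin]) auto
  note * = this
  have "class_prod G n r (\<lambda>i. f i \<otimes> g i) = finprod G (\<lambda>i. f i \<otimes> g i) ?F"
    using cl by (intro *) auto
  also have "\<dots> = finprod G f ?F \<otimes> finprod G g ?F"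
    using cl by (intro finprod_multf) auto
  also have "finprod G f ?F = class_prod G n r f" using cl by (intro *[symmetric]) auto
  also have "finprod G g ?F = class_prod G n r g" using cl by (intro *[symmetric]) auto
  finally show ?thesis .
qed

text \<open>As \<open>r\<close> matters only modulo \<open>n\<close>, this is the multiplication law
  for the base coordinates in the wreath product with the integers modulo \<open>n\<close>.\<close>

lemma class_prod_mult_wreath_int:
  assumes "(f, k) \<in> carrier (wreath_int G)" "(g, l) \<in> carrier (wreath_int G)"
  shows "class_prod G n r (\<lambda>i. f i \<otimes> g (i - k)) =
    class_prod G n r f \<otimes> class_prod G n (r - k) g"
proof -
  have "(\<lambda>i. g (i - k), l) \<in> carrier (wreath_int G)"
    using assms(2) finite_shift[of "\<lambda>i. g i \<noteq> \<one>" k]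
    by (auto simp: carrier_wreath_int[OF is_group])
  then show ?thesis
    using class_prod_mult[OF assms(1)] class_prod_shift[OF assms(2)] by simp
qed

text \<open>The interval \<open>{0..<n}\<close> meets each residue class exactly once, so at most
  one factor is nontrivial. Class products can thus be prescribed one by one.\<close>

lemma class_prod_supported:
  assumes f: "\<And>i. f i \<in> carrier G" "\<And>i. f i \<noteq> \<one> \<Longrightarrow> 0 \<le> i \<and> i < n" and n: "n > 0"
  shows "class_prod G n r f = f (r mod n)"
proof -
  have "class_prod G n r f = finprod G f {r mod n}"
    unfolding class_prod_def
  proof (rule finprod_mono_neutral_cong_left)
    show "{i. n dvd i - r \<and> f i \<noteq> \<one>} \<subseteq> {r mod n}"
      using f(2) by (force simp: mod_eq_dvd_iff[symmetric])
    have "n dvd r mod n - r" by (simp add: mod_eq_dvd_iff[symmetric])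
    then show "f i = \<one>" if "i \<in> {r mod n} - {i. n dvd i - r \<and> f i \<noteq> \<one>}" for i
      using that by auto
  qed (use f in auto)
  also have "\<dots> = f (r mod n)"
    using f(1) by simp
  finally show ?thesis .
qed

text \<open>Inverses and conjugates need no explicit formula: class products are taken on both sides
  of their defining equations, and the resulting equation is solved in the abelian group.\<close>

lemma normal_class_subgroup:
  assumes "subgroup B G"
  shows "class_subgroup G B n \<lhd> wreath_int G"
proof -
  interpret B: subgroup B G by fact
  interpret W: group "wreath_int G" by (rule group_wreath_int[OF is_group])
  let ?W = "wreath_int G" and ?N = "class_subgroup G B n"
  have sub: "subgroup ?N ?W"
  proof (rule W.subgroupI)
    show "?N \<subseteq> carrier ?W" by (auto simp: class_subgroup_def)
    have "\<one>\<^bsub>?W\<^esub> \<in> ?N"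
      using W.one_closed by (simp add: class_subgroup_def one_wreath_int class_prod_one)
    then show "?N \<noteq> {}" by blast
  next
    fix x assume x: "x \<in> ?N"
    then have xW: "x \<in> carrier ?W" by (auto simp: class_subgroup_def)
    obtain f k g l where eq: "x = (f, k)" "inv\<^bsub>?W\<^esub> x = (g, l)" by (metis surj_pair)
    have f: "(f, k) \<in> carrier ?W" and g: "(g, l) \<in> carrier ?W"
      using xW W.inv_closed[OF xW] unfolding eq(2) by (simp_all add: eq(1))
    have "(g, l) \<otimes>\<^bsub>?W\<^esub> (f, k) = \<one>\<^bsub>?W\<^esub>" using W.l_inv[OF xW] eq by simp
    then have *: "(\<lambda>i. g i \<otimes> f (i - l)) = (\<lambda>i. \<one>)" "l = - k"
      by (auto simp: mult_wreath_int one_wreath_int)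
    have "class_prod G n r g \<in> B" for r
    proof -
      have "class_prod G n r g \<otimes> class_prod G n (r - l) f = \<one>"
        using class_prod_mult_wreath_int[OF g f, of n r] by (simp only: *(1) class_prod_one)
      then have "class_prod G n r g = inv (class_prod G n (r - l) f)"
        using class_prod_closed f g by (metis inv_equality)
      then show ?thesis using x eq by (auto simp: class_subgroup_def)
    qed
    then show "inv\<^bsub>?W\<^esub> x \<in> ?N"
      using x g * eq by (auto simp: class_subgroup_def)
  next
    fix x y assume xy: "x \<in> ?N" "y \<in> ?N"
    obtain f k g l where eq: "x = (f, k)" "y = (g, l)" by (metis surj_pair)
    have fg: "(f, k) \<in> carrier ?W" "(g, l) \<in> carrier ?W"
      using xy eq by (auto simp: class_subgroup_def)
    from W.m_closed[OF this] xy eq show "x \<otimes>\<^bsub>?W\<^esub> y \<in> ?N"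
      by (auto simp: class_subgroup_def mult_wreath_int class_prod_mult_wreath_int[OF fg])
  qed
  show ?thesis
  proof (rule W.normal_invI[OF sub])
    fix h x assume h: "h \<in> ?N" and x: "x \<in> carrier ?W"
    let ?y = "x \<otimes>\<^bsub>?W\<^esub> h \<otimes>\<^bsub>?W\<^esub> inv\<^bsub>?W\<^esub> x"
    have hW: "h \<in> carrier ?W" using h by (auto simp: class_subgroup_def)
    have yW: "?y \<in> carrier ?W" and yx: "?y \<otimes>\<^bsub>?W\<^esub> x = x \<otimes>\<^bsub>?W\<^esub> h"
      using hW x by (simp_all add: W.m_assoc)
    obtain f k g l u m where eq: "h = (f, k)" "x = (g, l)" "?y = (u, m)" by (metis surj_pair)
    have f: "(f, k) \<in> carrier ?W" and g: "(g, l) \<in> carrier ?W" and u: "(u, m) \<in> carrier ?W"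
      using hW x yW unfolding eq(3) by (simp_all add: eq(1,2))
    have *: "(\<lambda>i. u i \<otimes> g (i - m)) = (\<lambda>i. g i \<otimes> f (i - l))" "m = k"
      using yx unfolding eq(3) unfolding eq(1,2) by (auto simp: mult_wreath_int)
    have k: "n dvd k" using h eq by (auto simp: class_subgroup_def)
    have "class_prod G n r u \<in> B" for r
    proof -
      have "class_prod G n r u \<otimes> class_prod G n (r - m) g =
          class_prod G n r g \<otimes> class_prod G n (r - l) f"
        using class_prod_mult_wreath_int[OF u g, of n r] class_prod_mult_wreath_int[OF g f, of n r]
        by (simp only: *(1))
      \<comment> \<open>Because \<open>n\<close> divides \<open>m = k\<close>, the shift by
        \<open>m\<close> preserves residue classes; the two class products of \<open>g\<close> agree
        and cancel by commutativity.\<close>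
      moreover have "class_prod G n (r - m) g = class_prod G n r g"
        using k * by (intro class_prod_cong) simp
      ultimately have "class_prod G n r u = class_prod G n (r - l) f"
        using class_prod_closed[OF u] class_prod_closed[OF f] class_prod_closed[OF g]
        by (metis m_comm r_cancel)
      then show ?thesis using h eq by (auto simp: class_subgroup_def)
    qed
    then show "?y \<in> ?N" using u k * unfolding eq(3) by (auto simp: class_subgroup_def)
  qed
qed

section \<open>Words of length linear in \<open>n\<close> reaching every coset\<close>

text \<open>Reading off \<open>f 0, f 1, \<dots>\<close> while the cursor moves to the right; on the right of the support
  only the cursor moves.\<close>

lemma word_prod_wreath_int:
  assumes "\<And>i. f i \<in> carrier G"
  shows "word_prod (wreath_int G) (map (\<lambda>i. (\<lambda>j. if j = 0 then f (int i) else \<one>, 1)) [0..<m]) =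
    (\<lambda>i. if 0 \<le> i \<and> i < int m then f i else \<one>, int m)"
proof (induction m)
  case 0
  show ?case by (auto simp: one_wreath_int fun_eq_iff)
next
  case (Suc m)
  interpret W: group "wreath_int G" by (rule group_wreath_int[OF is_group])
  have cl: "(\<lambda>j. if j = 0 then f (int i) else \<one>, 1) \<in> carrier (wreath_int G)" for i
    using assms by (auto simp: carrier_wreath_int[OF is_group])
  then have c1: "set (map (\<lambda>i. (\<lambda>j. if j = 0 then f (int i) else \<one>, 1)) [0..<m])
      \<subseteq> carrier (wreath_int G)"
    and c2: "set [(\<lambda>j. if j = 0 then f (int m) else \<one>, 1)] \<subseteq> carrier (wreath_int G)"
    by auto
  \<comment> \<open>When the last letter is read, the cursor stands at \<open>int m\<close>, so that
    letter writes coordinate \<open>int m\<close>.\<close>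
  have "word_prod (wreath_int G) (map (\<lambda>i. (\<lambda>j. if j = 0 then f (int i) else \<one>, 1)) [0..<Suc m]) =
      (\<lambda>i. if 0 \<le> i \<and> i < int m then f i else \<one>, int m) \<otimes>\<^bsub>wreath_int G\<^esub>
      (\<lambda>j. if j = 0 then f (int m) else \<one>, 1)"
    using W.word_prod_append[OF c1 c2] Suc.IH cl[of m] by simp
  also have "\<dots> = (\<lambda>i. if 0 \<le> i \<and> i < int (Suc m) then f i else \<one>, int (Suc m))"
    using assms by (auto simp: mult_wreath_int)
  finally show ?case .
qed

text \<open>The first \<open>n\<close> letters write representatives of the class products of
  \<open>x\<close>; fewer than \<open>n\<close> further letters bring the cursor to the right
  residue. The latter write \<open>\<one>\<close>, and \<open>\<one> \<in> R\<close> puts them into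
  the same alphabet.\<close>

lemma class_subgroup_short_words:
  assumes B: "subgroup B G" and R: "R \<subseteq> carrier G" "\<one> \<in> R"
    and cover: "\<And>a. a \<in> carrier G \<Longrightarrow> \<exists>r \<in> R. a \<otimes> inv r \<in> B"
    and n: "n > 0" and x: "x \<in> carrier (wreath_int G)"
  shows "\<exists>us. set us \<subseteq> (\<lambda>a. (\<lambda>j. if j = 0 then a else \<one>, 1)) ` R \<and> length us \<le> 2 * n \<and>
    x \<in> class_subgroup G B (int n) #>\<^bsub>wreath_int G\<^esub> word_prod (wreath_int G) us"
proof -
  interpret B: subgroup B G by fact
  interpret W: group "wreath_int G" by (rule group_wreath_int[OF is_group])
  let ?W = "wreath_int G" and ?P = "class_prod G (int n)"
  obtain f k where eq: "x = (f, k)" by (metis surj_pair)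
  have f: "(f, k) \<in> carrier ?W" using x eq by simp
  have "\<exists>\<rho>. \<forall>r. \<rho> r \<in> R \<and> ?P r f \<otimes> inv \<rho> r \<in> B"
    using cover[OF class_prod_closed[OF f]] by (intro choice) blast
  then obtain \<rho> where \<rho>: "\<And>r. \<rho> r \<in> R" "\<And>r. ?P r f \<otimes> inv \<rho> r \<in> B" by blast
  define g where "g = (\<lambda>i. if 0 \<le> i \<and> i < int n then \<rho> i else \<one>)"
  \<comment> \<open>This end position is congruent to \<open>k\<close> modulo \<open>n\<close>, is
    at least \<open>n\<close>, so that all of \<open>g\<close> gets written, and is below
    \<open>2 * n\<close>.\<close>
  define m where "m = n + nat (k mod int n)"
  have gR: "g i \<in> R" and gc: "g i \<in> carrier G" for i
    using \<rho>(1) R by (auto simp: g_def)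
  have supp: "0 \<le> i \<and> i < int n" if "g i \<noteq> \<one>" for i
    using that by (auto simp: g_def split: if_splits)
  have "finite {i. g i \<noteq> \<one>}"
    by (rule finite_subset[of _ "{0..<int n}"]) (use supp in auto)
  then have g: "(g, int m) \<in> carrier ?W"
    using gc by (auto simp: carrier_wreath_int[OF is_group])
  have Pg: "?P r g = \<rho> (r mod int n)" for r
  proof -
    have "?P r g = g (r mod int n)"
      by (rule class_prod_supported) (use gc supp n in auto)
    then show ?thesis using n by (simp add: g_def)
  qed
  let ?us = "map (\<lambda>i. (\<lambda>j. if j = 0 then g (int i) else \<one>, 1::int)) [0..<m]"
  have word: "word_prod ?W ?us = (g, int m)"
    unfolding word_prod_wreath_int[of g m, OF gc]
    by (auto simp: g_def m_def fun_eq_iff)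
  obtain u l where eq': "x \<otimes>\<^bsub>?W\<^esub> inv\<^bsub>?W\<^esub> (g, int m) = (u, l)" by (metis surj_pair)
  then have u: "(u, l) \<in> carrier ?W" using x g by (metis W.inv_closed W.m_closed)
  have xu: "x = (u, l) \<otimes>\<^bsub>?W\<^esub> (g, int m)"
    using x g by (simp add: eq'[symmetric] W.m_assoc)
  then have f_eq: "f = (\<lambda>i. u i \<otimes> g (i - l))" and l: "l = k - int m"
    using eq by (auto simp: mult_wreath_int)
  have "k - int m = int n * (k div int n) - int n"
    using n minus_mod_eq_mult_div[of k "int n"] by (simp add: m_def)
  then have ndvd: "int n dvd l" by (simp add: l)
  have "?P r u \<in> B" for r
  proof -
    \<comment> \<open>The choice function \<open>\<rho>\<close> need not be periodic, and
      \<open>g\<close> uses only its values on \<open>{0..<int n}\<close>; hence the passage from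
      \<open>r\<close> to its residue.\<close>
    let ?s = "r mod int n"
    have s: "?P r h = ?P ?s h" for h
      by (intro class_prod_cong) (simp add: minus_mod_eq_mult_div)
    have "?P r f = ?P r u \<otimes> ?P (r - l) g"
      using class_prod_mult_wreath_int[OF u g] by (simp add: f_eq)
    also have "?P (r - l) g = \<rho> ?s"
      using class_prod_cong[of "int n" "r - l" r g] ndvd by (simp add: Pg)
    finally have "?P r u = ?P ?s f \<otimes> inv \<rho> ?s"
      using class_prod_closed[OF u] class_prod_closed[OF f] \<rho>(1) R s
      by (metis inv_solve_right subsetD)
    then show ?thesis using \<rho>(2) by simp
  qed
  then have "(u, l) \<in> class_subgroup G B (int n)"
    using u ndvd by (auto simp: class_subgroup_def)
  then have "x \<in> class_subgroup G B (int n) #>\<^bsub>?W\<^esub> word_prod ?W ?us"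
    unfolding word using xu by (auto simp: r_coset_def)
  moreover have "nat (k mod int n) \<le> n"
    using n pos_mod_bound[of "int n" k] by linarith
  then have "length ?us \<le> 2 * n" by (simp add: m_def)
  ultimately show ?thesis using gR by (intro exI[of _ ?us]) auto
qed

section \<open>Exponential lower bound for the order of the quotients\<close>

text \<open>The lower bound comes from the cosets of the families with values in \<open>{\<one>, a}\<close>, where
  \<open>a \<notin> B\<close>.\<close>

lemma class_subgroup_index:
  assumes B: "subgroup B G" "B \<noteq> carrier G" and n: "n > 0"
    and fin: "finite (carrier (wreath_int G Mod class_subgroup G B (int n)))"
  shows "class_subgroup G B (int n) \<noteq> carrier (wreath_int G)"
    and "2 ^ n \<le> order (wreath_int G Mod class_subgroup G B (int n))"
proof -
  interpret B: subgroup B G by fact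
  interpret W: group "wreath_int G" by (rule group_wreath_int[OF is_group])
  let ?W = "wreath_int G" and ?P = "class_prod G (int n)" and ?N = "class_subgroup G B (int n)"
  obtain a where a: "a \<in> carrier G" "a \<notin> B" using B(2) B.subset by blast
  define ind where "ind = (\<lambda>(U :: int set) i. if i \<in> U then a else \<one>)"
  have indc: "(ind U, 0) \<in> carrier ?W" if "U \<subseteq> {0..<int n}" for U
  proof -
    have "finite {i. ind U i \<noteq> \<one>}"
      by (rule finite_subset[of _ "{0..<int n}"]) (use that in \<open>auto simp: ind_def split: if_splits\<close>)
    then show ?thesis using a by (auto simp: carrier_wreath_int[OF is_group] ind_def)
  qed
  have Pind: "?P r (ind U) = ind U r" if "U \<subseteq> {0..<int n}" "r \<in> {0..<int n}" for U r
  proof -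
    have "?P r (ind U) = ind U (r mod int n)"
      by (rule class_prod_supported) (use a that n in \<open>auto simp: ind_def split: if_splits\<close>)
    then show ?thesis using that by simp
  qed
  have "(ind {0}, 0) \<notin> ?N"
    using Pind[of "{0}" 0] n a by (auto simp: class_subgroup_def ind_def intro!: exI[of _ 0])
  then show "?N \<noteq> carrier ?W" using indc[of "{0}"] n by auto
  have sub: "subgroup ?N ?W" using normal_class_subgroup[OF B(1)] by (rule normal_imp_subgroup)
  \<comment> \<open>One inclusion suffices for injectivity, since the assumptions are symmetric in
    \<open>U\<close> and \<open>V\<close>. An element \<open>r\<close> of \<open>U\<close> outside
    \<open>V\<close> would give \<open>a = ?P r h\<close>, which lies in \<open>B\<close>.\<close>
  have le: "U \<subseteq> V"
    if UV: "U \<subseteq> {0..<int n}" "V \<subseteq> {0..<int n}"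
      and eq: "?N #>\<^bsub>?W\<^esub> (ind U, 0) = ?N #>\<^bsub>?W\<^esub> (ind V, 0)" for U V
  proof
    fix r assume r: "r \<in> U"
    have "(ind U, 0) \<in> ?N #>\<^bsub>?W\<^esub> (ind V, 0)"
      using W.rcos_self[OF indc[OF UV(1)] sub] eq by simp
    then obtain h k where h: "(h, k) \<in> ?N" and *: "(ind U, 0) = (h, k) \<otimes>\<^bsub>?W\<^esub> (ind V, 0)"
      by (force simp: r_coset_def)
    from * have k: "k = 0" and U: "ind U = (\<lambda>i. h i \<otimes> ind V (i - 0))"
      by (simp_all add: mult_wreath_int)
    have "?P r (ind U) = ?P r h \<otimes> ?P (r - 0) (ind V)"
      unfolding U using h k
      by (intro class_prod_mult_wreath_int[OF _ indc[OF UV(2)]]) (auto simp: class_subgroup_def)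
    moreover have "r \<in> {0..<int n}" using r UV by blast
    ultimately have "a = ?P r h \<otimes> ind V r"
      using r UV Pind[of U r] Pind[of V r] by (simp add: ind_def)
    moreover have "?P r h \<in> B" using h by (auto simp: class_subgroup_def)
    ultimately show "r \<in> V" using a by (auto simp: ind_def split: if_splits)
  qed
  let ?c = "\<lambda>U. ?N #>\<^bsub>?W\<^esub> (ind U, 0)"
  have "inj_on ?c (Pow {0..<int n})" by (rule inj_onI) (use le in blast)
  then have "card (?c ` Pow {0..<int n}) = 2 ^ n" by (simp add: card_image card_Pow)
  moreover have "?c ` Pow {0..<int n} \<subseteq> carrier (?W Mod ?N)"
    using indc by (auto simp: carrier_FactGroup)
  ultimately show "2 ^ n \<le> order (?W Mod ?N)"
    unfolding order_def using card_mono[OF fin] by metis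
qed

end

section \<open>Linear diameter against exponential order\<close>

text \<open>After division by \<open>c ^ n\<close>, where \<open>c = 2 powr \<alpha>\<close> exceeds
  1, this is the convergence of \<open>n / c ^ n\<close> to 0.\<close>

lemma linear_less_powr:
  fixes K \<epsilon> \<alpha> :: real
  assumes "\<epsilon> > 0" "\<alpha> > 0"
  shows "\<exists>n>0. K * real n < \<epsilon> * (2 ^ n) powr \<alpha>"
proof -
  define c where "c = 2 powr \<alpha>"
  have c: "c > 1" using assms by (simp add: c_def)
  have "(\<lambda>n. K * (real n * (1 / c) ^ n)) \<longlonglongrightarrow> K * 0"
    using c by (intro tendsto_mult tendsto_const powser_times_n_limit_0) simp
  then have "eventually (\<lambda>n. K * (real n * (1 / c) ^ n) < \<epsilon>) sequentially"
    using assms by (intro order_tendstoD(2)[where y = "K * 0"]) auto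
  then have "eventually (\<lambda>n. n > 0 \<and> K * (real n * (1 / c) ^ n) < \<epsilon>) sequentially"
    using eventually_gt_at_top[of 0] by (intro eventually_conj)
  then obtain n where n: "n > 0" "K * (real n * (1 / c) ^ n) < \<epsilon>"
    by (metis (mono_tags, lifting) eventually_sequentially order_refl)
  have "(2 ^ n) powr \<alpha> = c ^ n"
    by (simp add: c_def powr_power powr_powr mult.commute flip: powr_realpow)
  then show ?thesis using n c by (intro exI[of _ n]) (auto simp: field_simps power_divide)
qed

theorem theorem1p7:
  fixes A :: "('a, 'b) monoid_scheme" and S :: "((int \<Rightarrow> 'a) \<times> int) set"
  assumes "comm_group A"
    and "\<exists>T. finitely_generated_by A T"
    and "carrier A \<noteq> {\<one>\<^bsub>A\<^esub>}"
    and "finitely_generated_by (wreath_int A) S"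
  shows "\<not> uniformly_almost_flat_quotients (wreath_int A) S"
proof
  assume "uniformly_almost_flat_quotients (wreath_int A) S"
  then obtain \<alpha> \<epsilon> :: real where pos: "\<alpha> > 0" "\<epsilon> > 0"
    and uq: "\<And>N. N \<lhd> wreath_int A \<Longrightarrow> finite (carrier (wreath_int A Mod N)) \<Longrightarrow>
      N \<noteq> carrier (wreath_int A) \<Longrightarrow>
      real (quotient_diam (wreath_int A) S N) \<ge> \<epsilon> * real (order (wreath_int A Mod N)) powr \<alpha>"
    by (auto simp: uniformly_almost_flat_quotients_def uq_alpha_def)
  interpret A: comm_group A by fact
  interpret W: group "wreath_int A" by (rule group_wreath_int[OF A.is_group])
  obtain B R where B: "subgroup B A" "B \<noteq> carrier A"
    and R: "finite R" "R \<subseteq> carrier A" "\<one>\<^bsub>A\<^esub> \<in> R"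
    and cover: "\<And>a. a \<in> carrier A \<Longrightarrow> \<exists>r \<in> R. a \<otimes>\<^bsub>A\<^esub> inv\<^bsub>A\<^esub> r \<in> B"
    using assms A.ex_proper_subgroup_finite_transversal unfolding finitely_generated_by_def
    by metis
  let ?W = "wreath_int A" and ?N = "\<lambda>n. class_subgroup A B (int n)"
  \<comment> \<open>Each letter writes an element of \<open>R\<close> at the cursor and then moves
    one place to the right.\<close>
  define Y where "Y = (\<lambda>a. (\<lambda>j::int. if j = 0 then a else \<one>\<^bsub>A\<^esub>, 1::int)) ` R"
  have Y: "finite Y" "Y \<subseteq> carrier ?W"
    using R by (auto simp: Y_def carrier_wreath_int[OF A.is_group])
  obtain L where L: "\<And>N m. N \<lhd> ?W \<Longrightarrow>
      \<forall>x \<in> carrier ?W. \<exists>us. set us \<subseteq> Y \<and> length us \<le> m \<and> x \<in> N #>\<^bsub>?W\<^esub> word_prod ?W us \<Longrightarrow>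
      quotient_diam ?W S N \<le> L * m"
    using W.quotient_diam_le_words[OF _ _ Y, of S] assms(4)
    unfolding finitely_generated_by_def by metis
  \<comment> \<open>Since \<open>L\<close> does not depend on \<open>n\<close>, it may be fixed
    first; the factor 2 comes from the word length \<open>2 * n\<close>.\<close>
  obtain n where n: "n > 0" "real (L * 2) * real n < \<epsilon> * (2 ^ n) powr \<alpha>"
    using linear_less_powr[OF pos(2,1)] by blast
  have N: "?N n \<lhd> ?W" by (rule A.normal_class_subgroup[OF B(1)])
  have words: "\<exists>us. set us \<subseteq> Y \<and> length us \<le> 2 * n \<and> x \<in> ?N n #>\<^bsub>?W\<^esub> word_prod ?W us"
    if "x \<in> carrier ?W" for x
    unfolding Y_def using A.class_subgroup_short_words[OF B(1) R(2,3) cover n(1) that] by blast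
  \<comment> \<open>Finiteness of the quotient also follows from the short words: there are only
    finitely many of them over \<open>Y\<close>, and they reach every coset.\<close>
  have "carrier (?W Mod ?N n) \<subseteq>
      (\<lambda>us. ?N n #>\<^bsub>?W\<^esub> word_prod ?W us) ` {us. set us \<subseteq> Y \<and> length us \<le> 2 * n}"
  proof
    fix y assume "y \<in> carrier (?W Mod ?N n)"
    then obtain x where x: "x \<in> carrier ?W" "y = ?N n #>\<^bsub>?W\<^esub> x"
      by (auto simp: carrier_FactGroup)
    obtain us where us: "set us \<subseteq> Y" "length us \<le> 2 * n" "x \<in> ?N n #>\<^bsub>?W\<^esub> word_prod ?W us"
      using words[OF x(1)] by blast
    have "y = ?N n #>\<^bsub>?W\<^esub> word_prod ?W us"
      using W.repr_independence[OF us(3) W.word_prod_closed normal_imp_subgroup[OF N]] us Y x by auto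
    then show "y \<in> (\<lambda>us. ?N n #>\<^bsub>?W\<^esub> word_prod ?W us) ` {us. set us \<subseteq> Y \<and> length us \<le> 2 * n}"
      using us by blast
  qed
  then have fin: "finite (carrier (?W Mod ?N n))"
    using finite_lists_length_le[OF Y(1)] finite_surj by blast
  have "\<epsilon> * (2 ^ n) powr \<alpha> \<le> \<epsilon> * real (order (?W Mod ?N n)) powr \<alpha>"
  proof -
    have "(2::real) ^ n \<le> real (order (?W Mod ?N n))"
      using A.class_subgroup_index(2)[OF B n(1) fin] by (metis of_nat_le_iff of_nat_numeral of_nat_power)
    then show ?thesis using pos by (intro mult_left_mono powr_mono2) auto
  qed
  also have "\<dots> \<le> real (quotient_diam ?W S (?N n))"
    by (rule uq[OF N fin A.class_subgroup_index(1)[OF B n(1) fin]])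
  also have "\<dots> \<le> real (L * (2 * n))"
    using L[OF N, of "2 * n"] words of_nat_le_iff by blast
  finally show False using n(2) by simp
qed

end
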